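(* Let $T^r$ be a tree rooted at $r$, and let $\pi$ be a projective arrangement of $T^r$ whose cost is maximum among all projective arrangements of $T^r$. Then: (i) for every vertex $u$, the immediate subtrees of $T^r_u$ all lie on the same side of $u$ in $\pi$ (all their vertices are to the left of $\pi(u)$, or all are to the right of $\pi(u)$), and they appear ordered non-increasingly by size as one moves away from $u$: the largest immediate subtree is closest to $u$ and the smallest one is farthest from $u$; (ii) for every directed edge $(u,v)$ of $T^r$ ($v$ a child of $u$), if the arrangement of $T^r_u$ is left branching then the arrangement of $T^r_v$ is right branching, and if the arrangement of $T^r_u$ is right branching then the arrangement of $T^r_v$ is left branching.
   Context: A linear arrangement of a graph $G=(V,E)$ with $n=|V|$ is a bijection $\pi:V\to\{1,\dots,n\}$. The length of an edge $uv$ is $|\pi(u)-\pi(v)|$ and the cost of $\pi$ is the sum of the lengths of all edges. Two edges $st,uv$ with $\pi(s)<\pi(t)$, $\pi(u)<\pi(v)$, $\pi(s)<\pi(u)$ cross if $\pi(s)<\pi(u)<\pi(t)<\pi(v)$; an arrangement is planar if no two edges cross. An edge $uv$ with $\pi(u)<\pi(v)$ covers a vertex $w$ if $\pi(u)<\pi(w)<\pi(v)$. For a rooted tree $T^r$ (edges oriented away from the root $r$), an arrangement is projective if it is planar and no edge covers $r$. For a vertex $u$, $T^r_u$ denotes the subtree of $T^r$ rooted at $u$ ($u$ and all its descendants); its immediate subtrees are the subtrees $T^r_v$ for the children $v$ of $u$, and the size of a subtree is its number of vertices. The arrangement of a subtree $T^r_u$ (the restriction of $\pi$ to its vertices) is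 called right branching if $u$ occupies the leftmost position among the vertices of $T^r_u$, and left branching if $u$ occupies the rightmost position among them. *)

theory Defs
  imports "Graph_Theory.Arc_Walk"
begin

text \<open>
  The orientation of all edges away from the root is expressed by the existence of exactly one
  directed walk from the root to every vertex. The library constant \<open>tree\<close> is not used: applied to
  a digraph it only excludes directed cycles, and applied to a symmetric digraph it
  regards an edge traversed back and forth as a cycle.
\<close>

locale rooted_tree = digraph T for T :: "('a, 'b) pre_digraph" (structure) +
  fixes r :: 'a
  assumes root_in_verts: "r \<in> verts T"
    and unique_walk_from_root: "v \<in> verts T \<Longrightarrow> \<exists>!p. awalk r p v"

text \<open>Length, crossing and covering refer to edges irrespective of their orientation.\<close>

definition adjacent :: "('a, 'b) pre_digraph \<Rightarrow> 'a \<Rightarrow> 'a \<Rightarrow> bool" where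
  "adjacent T u v \<longleftrightarrow> u \<rightarrow>\<^bsub>T\<^esub> v \<or> v \<rightarrow>\<^bsub>T\<^esub> u"

definition linear_arrangement :: "('a, 'b) pre_digraph \<Rightarrow> ('a \<Rightarrow> nat) \<Rightarrow> bool" where
  "linear_arrangement T \<pi> \<longleftrightarrow> bij_betw \<pi> (verts T) {1..card (verts T)}"

definition pos_dist :: "('a \<Rightarrow> nat) \<Rightarrow> 'a \<Rightarrow> 'a \<Rightarrow> int" where
  "pos_dist \<pi> u v = \<bar>int (\<pi> u) - int (\<pi> v)\<bar>"

definition cost :: "('a, 'b) pre_digraph \<Rightarrow> ('a \<Rightarrow> nat) \<Rightarrow> int" where
  "cost T \<pi> = (\<Sum>e \<in> arcs T. pos_dist \<pi> (tail T e) (head T e))"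

definition planar :: "('a, 'b) pre_digraph \<Rightarrow> ('a \<Rightarrow> nat) \<Rightarrow> bool" where
  "planar T \<pi> \<longleftrightarrow> linear_arrangement T \<pi> \<and>
    \<not> (\<exists>s t u v. adjacent T s t \<and> adjacent T u v \<and> \<pi> s < \<pi> u \<and> \<pi> u < \<pi> t \<and> \<pi> t < \<pi> v)"

definition covers :: "('a \<Rightarrow> nat) \<Rightarrow> 'a \<Rightarrow> 'a \<Rightarrow> 'a \<Rightarrow> bool" where
  "covers \<pi> u v w \<longleftrightarrow> \<pi> u < \<pi> w \<and> \<pi> w < \<pi> v"

definition projective :: "('a, 'b) pre_digraph \<Rightarrow> 'a \<Rightarrow> ('a \<Rightarrow> nat) \<Rightarrow> bool" where
  "projective T r \<pi> \<longleftrightarrow> planar T \<pi> \<and> \<not> (\<exists>u v. adjacent T u v \<and> covers \<pi> u v r)"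

definition max_projective :: "('a, 'b) pre_digraph \<Rightarrow> 'a \<Rightarrow> ('a \<Rightarrow> nat) \<Rightarrow> bool" where
  "max_projective T r \<pi> \<longleftrightarrow>
    projective T r \<pi> \<and> (\<forall>\<pi>'. projective T r \<pi>' \<longrightarrow> cost T \<pi>' \<le> cost T \<pi>)"

definition children :: "('a, 'b) pre_digraph \<Rightarrow> 'a \<Rightarrow> 'a set" where
  "children T u = {v. u \<rightarrow>\<^bsub>T\<^esub> v}"

definition subtree :: "('a, 'b) pre_digraph \<Rightarrow> 'a \<Rightarrow> 'a set" where
  "subtree T u = {w. u \<rightarrow>\<^sup>*\<^bsub>T\<^esub> w}"

definition right_branching :: "('a, 'b) pre_digraph \<Rightarrow> ('a \<Rightarrow> nat) \<Rightarrow> 'a \<Rightarrow> bool" where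
  "right_branching T \<pi> u \<longleftrightarrow> (\<forall>w \<in> subtree T u. \<pi> u \<le> \<pi> w)"

definition left_branching :: "('a, 'b) pre_digraph \<Rightarrow> ('a \<Rightarrow> nat) \<Rightarrow> 'a \<Rightarrow> bool" where
  "left_branching T \<pi> u \<longleftrightarrow> (\<forall>w \<in> subtree T u. \<pi> w \<le> \<pi> u)"

definition children_on_one_side :: "('a, 'b) pre_digraph \<Rightarrow> ('a \<Rightarrow> nat) \<Rightarrow> 'a \<Rightarrow> bool" where
  "children_on_one_side T \<pi> u \<longleftrightarrow>
    (\<forall>v \<in> children T u. \<forall>w \<in> subtree T v. \<pi> w < \<pi> u) \<or>
    (\<forall>v \<in> children T u. \<forall>w \<in> subtree T v. \<pi> u < \<pi> w)"

text \<open>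
  The list enumerates the children of \<open>u\<close> by increasing distance of their subtrees from \<open>u\<close>. Every
  vertex of an earlier subtree is closer to \<open>u\<close> than every vertex of a later one, so the
  subtrees are not interleaved.
\<close>

definition children_sorted_by_size :: "('a, 'b) pre_digraph \<Rightarrow> ('a \<Rightarrow> nat) \<Rightarrow> 'a \<Rightarrow> bool" where
  "children_sorted_by_size T \<pi> u \<longleftrightarrow>
    (\<exists>vs. distinct vs \<and> set vs = children T u \<and>
      sorted_wrt (\<lambda>v w. \<forall>x \<in> subtree T v. \<forall>y \<in> subtree T w. pos_dist \<pi> u x < pos_dist \<pi> u y) vs \<and>
      sorted_wrt (\<lambda>v w. card (subtree T v) \<ge> card (subtree T w)) vs)"

end

theory Submission
  imports Defs
begin

text \<open>
  An arrangement is projective iff every subtree occupies an interval. Hence the vertices on the way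
  from \<open>u\<close> to a child \<open>v\<close> all lie in subtrees of children \<open>z\<close> of \<open>u\<close> situated between \<open>u\<close> and \<open>v\<close>
  (including \<open>v\<close>), and the length of the edge is at most the total size of these subtrees. Summing
  over the children of \<open>u\<close>, every pair of siblings contributes at most the larger of their two sizes.
  The resulting bound on the cost depends on the tree only, and it is attained by stacking the child
  subtrees by decreasing size on one side and alternating the direction at every level. A maximum
  arrangement therefore makes all these inequalities equalities: equality in the edge bound puts
  \<open>v\<close> at the far end of its subtree, and equality for a pair of siblings puts them on the same side of
  \<open>u\<close> with the larger subtree closer to \<open>u\<close>.
\<close>

section \<open>Convexity of subtrees, segments and stacked layouts\<close>

definition convex_subtrees :: "('a, 'b) pre_digraph \<Rightarrow> ('a \<Rightarrow> nat) \<Rightarrow> bool" where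
  "convex_subtrees T \<pi> \<longleftrightarrow> (\<forall>u \<in> verts T. \<forall>x \<in> subtree T u. \<forall>z \<in> subtree T u. \<forall>y \<in> verts T.
    \<pi> x < \<pi> y \<longrightarrow> \<pi> y < \<pi> z \<longrightarrow> y \<in> subtree T u)"

text \<open>Leaving out \<open>u\<close> and keeping \<open>v\<close> makes the cardinality equal to
  the distance of \<open>u\<close> and \<open>v\<close>, on either side of \<open>u\<close>.\<close>

definition segment :: "('a, 'b) pre_digraph \<Rightarrow> ('a \<Rightarrow> nat) \<Rightarrow> 'a \<Rightarrow> 'a \<Rightarrow> 'a set" where
  "segment T \<pi> u v =
    {x \<in> verts T. \<pi> u < \<pi> x \<and> \<pi> x \<le> \<pi> v \<or> \<pi> v \<le> \<pi> x \<and> \<pi> x < \<pi> u}"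

text \<open>The order of siblings by decreasing subtree size; \<open>g\<close> is an injection that breaks ties.\<close>

definition precedes :: "('a, 'b) pre_digraph \<Rightarrow> ('a \<Rightarrow> nat) \<Rightarrow> 'a \<Rightarrow> 'a \<Rightarrow> bool" where
  "precedes T g z v \<longleftrightarrow> card (subtree T v) < card (subtree T z) \<or>
    card (subtree T v) = card (subtree T z) \<and> g z < g v"

text \<open>The distance of \<open>v\<close> from \<open>u\<close> when the child subtrees of
  \<open>u\<close> are stacked on one side in the order \<open>precedes\<close> and \<open>v\<close>
  is the outermost vertex of its own block.\<close>

definition stacked_size :: "('a, 'b) pre_digraph \<Rightarrow> ('a \<Rightarrow> nat) \<Rightarrow> 'a \<Rightarrow> 'a \<Rightarrow> nat" where
  "stacked_size T g u v =
    (\<Sum>z \<in> children T u. if z = v \<or> precedes T g z v then card (subtree T z) else 0)"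

text \<open>Integer offsets with \<open>u\<close> at 0, rather than positions, so that a layout can
  be reflected and shifted by a subtraction when it becomes a block of a larger one.\<close>

definition extremal_layout :: "('a, 'b) pre_digraph \<Rightarrow> ('a \<Rightarrow> nat) \<Rightarrow> 'a \<Rightarrow> ('a \<Rightarrow> int) \<Rightarrow> bool" where
  "extremal_layout T g u f \<longleftrightarrow>
    inj_on f (subtree T u) \<and> f ` subtree T u \<subseteq> {0..<int (card (subtree T u))} \<and> f u = 0 \<and>
    (\<forall>w \<in> subtree T u. \<forall>x \<in> subtree T w. \<forall>z \<in> subtree T w. \<forall>y \<in> subtree T u.
      f x < f y \<longrightarrow> f y < f z \<longrightarrow> y \<in> subtree T w) \<and>
    (\<forall>w \<in> subtree T u. \<forall>v \<in> children T w. \<bar>f w - f v\<bar> = int (stacked_size T g w v))"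

section \<open>Double sums over pairs, and injectivity of positions\<close>

lemma sum_pairs_le_if_symmetrized_le:
  fixes a b :: "'c \<Rightarrow> 'c \<Rightarrow> nat"
  assumes "\<And>v z. v \<in> C \<Longrightarrow> z \<in> C \<Longrightarrow> a v z + a z v \<le> b v z + b z v"
  shows "(\<Sum>v\<in>C. \<Sum>z\<in>C. a v z) \<le> (\<Sum>v\<in>C. \<Sum>z\<in>C. b v z)"
proof -
  \<comment> \<open>Adding the double sum to its transpose lets the two terms of an unordered pair
    be compared jointly, although neither need be comparable on its own.\<close>
  have twice: "2 * (\<Sum>v\<in>C. \<Sum>z\<in>C. h v z) = (\<Sum>v\<in>C. \<Sum>z\<in>C. h v z + h z v)" for h :: "'c \<Rightarrow> 'c \<Rightarrow> nat"
    using sum.swap[of h C C] by (simp add: sum.distrib)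
  have "(\<Sum>v\<in>C. \<Sum>z\<in>C. a v z + a z v) \<le> (\<Sum>v\<in>C. \<Sum>z\<in>C. b v z + b z v)"
    by (intro sum_mono assms)
  then show ?thesis unfolding twice[symmetric] by simp
qed

lemma symmetrized_eq_if_sum_pairs_eq:
  fixes a b :: "'c \<Rightarrow> 'c \<Rightarrow> nat"
  assumes "finite C"
    and le: "\<And>v z. v \<in> C \<Longrightarrow> z \<in> C \<Longrightarrow> a v z + a z v \<le> b v z + b z v"
    and eq: "(\<Sum>v\<in>C. \<Sum>z\<in>C. a v z) = (\<Sum>v\<in>C. \<Sum>z\<in>C. b v z)"
    and "v \<in> C" "z \<in> C"
  shows "a v z + a z v = b v z + b z v"
proof -
  have twice: "2 * (\<Sum>v\<in>C. \<Sum>z\<in>C. h v z) = (\<Sum>v\<in>C. \<Sum>z\<in>C. h v z + h z v)" for h :: "'c \<Rightarrow> 'c \<Rightarrow> nat"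
    using sum.swap[of h C C] by (simp add: sum.distrib)
  have sums: "(\<Sum>v\<in>C. \<Sum>z\<in>C. a v z + a z v) = (\<Sum>v\<in>C. \<Sum>z\<in>C. b v z + b z v)"
    using eq unfolding twice[symmetric] by simp
  have "(\<Sum>z\<in>C. a v z + a z v) = (\<Sum>z\<in>C. b v z + b z v)"
    by (rule sum_mono_inv[OF sums]) (use assms in \<open>auto intro!: sum_mono\<close>)
  then show ?thesis
    by (rule sum_mono_inv) (use assms in auto)
qed

lemma linear_arrangement_eq_iff:
  assumes "linear_arrangement T \<pi>" "a \<in> verts T" "b \<in> verts T"
  shows "\<pi> a = \<pi> b \<longleftrightarrow> a = b"
proof -
  have "inj_on \<pi> (verts T)"
    using assms(1) unfolding linear_arrangement_def by (rule bij_betw_imp_inj_on)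
  then show ?thesis using assms(2,3) by (rule inj_on_eq_iff)
qed

lemma projective_linear_arrangement: "projective T r \<pi> \<Longrightarrow> linear_arrangement T \<pi>"
  unfolding projective_def planar_def by (elim conjE)

context rooted_tree
begin

section \<open>Subtrees of a rooted tree\<close>

lemma subtree_subset_verts: "subtree T u \<subseteq> verts T"
  by (auto simp: subtree_def elim: reachable_in_vertsE)

lemma finite_subtree [simp]: "finite (subtree T u)"
  using finite_subset[OF subtree_subset_verts] by simp

lemma children_subset_verts: "children T u \<subseteq> verts T"
  by (auto simp: children_def dest: adj_in_verts)

lemma finite_children [simp]: "finite (children T u)"
  using finite_subset[OF children_subset_verts] by simp

lemma self_in_subtree: "u \<in> verts T \<Longrightarrow> u \<in> subtree T u"
  by (simp add: subtree_def)

lemma child_in_own_subtree: "v \<in> children T u \<Longrightarrow> v \<in> subtree T v"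
  using children_subset_verts self_in_subtree by blast

lemma subtree_child: "x \<in> subtree T u \<Longrightarrow> v \<in> children T x \<Longrightarrow> v \<in> subtree T u"
  by (auto simp: subtree_def children_def intro: reachable_adj_trans)

lemma subtree_trans: "x \<in> subtree T u \<Longrightarrow> y \<in> subtree T x \<Longrightarrow> y \<in> subtree T u"
  by (auto simp: subtree_def intro: reachable_trans)

lemma subtree_child_subset: "v \<in> children T u \<Longrightarrow> subtree T v \<subseteq> subtree T u"
  by (auto simp: subtree_def children_def intro: adj_reachable_trans)

lemma card_subtree_pos: "u \<in> verts T \<Longrightarrow> 0 < card (subtree T u)"
  using self_in_subtree by (auto simp: card_gt_0_iff)

lemma subtree_root: "subtree T r = verts T"
proof
  show "verts T \<subseteq> subtree T r"
    using ex1_implies_ex[OF unique_walk_from_root] by (auto simp: subtree_def reachable_awalk)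
qed (rule subtree_subset_verts)

text \<open>A closed detour through \<open>v\<close> could be appended to the walk from the root to
  \<open>u\<close>, giving a second walk to \<open>u\<close>.\<close>

lemma subtree_antisym:
  assumes "v \<in> subtree T u" "u \<in> subtree T v"
  shows "u = v"
proof (rule ccontr)
  assume "u \<noteq> v"
  obtain p q where p: "awalk u p v" and q: "awalk v q u"
    using assms by (auto simp: subtree_def reachable_awalk)
  have "p \<noteq> []" using p \<open>u \<noteq> v\<close> by (auto simp: awalk_def)
  have "u \<in> verts T" using p by (auto simp: awalk_def)
  obtain w where w: "awalk r w u"
    using unique_walk_from_root[OF \<open>u \<in> verts T\<close>] by blast
  have "awalk r (w @ p @ q) u"
    using w p q by (blast intro: awalk_appendI)
  then have "w @ p @ q = w"
    using unique_walk_from_root[OF \<open>u \<in> verts T\<close>] w by blast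
  then show False using \<open>p \<noteq> []\<close> by simp
qed

text \<open>Walks from the root to the two parents extend to walks to \<open>v\<close>; these
  coincide, and so do their last arcs.\<close>

lemma parent_unique:
  assumes "v \<in> children T u" "v \<in> children T u'"
  shows "u = u'"
proof -
  obtain e e' where e: "e \<in> arcs T" "tail T e = u" "head T e = v"
    and e': "e' \<in> arcs T" "tail T e' = u'" "head T e' = v"
    using assms by (auto simp: children_def arcs_ends_conv)
  have verts: "u \<in> verts T" "u' \<in> verts T" "v \<in> verts T" using e e' by auto
  obtain p p' where "awalk r p u" "awalk r p' u'"
    using ex1_implies_ex[OF unique_walk_from_root] verts(1,2) by metis
  moreover have "awalk u [e] v" "awalk u' [e'] v"
    using e e' by (auto simp: awalk_def)
  ultimately have "awalk r (p @ [e]) v" "awalk r (p' @ [e']) v"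
    by (blast intro: awalk_appendI)+
  then have "p @ [e] = p' @ [e']"
    using unique_walk_from_root[OF verts(3)] by blast
  then show ?thesis using e e' by simp
qed

lemma not_in_child_subtree: "v \<in> children T u \<Longrightarrow> u \<notin> subtree T v"
proof
  assume v: "v \<in> children T u" and "u \<in> subtree T v"
  then have "u = v"
    by (intro subtree_antisym) (auto simp: subtree_def children_def)
  then show False using v adj_not_same by (auto simp: children_def)
qed

lemma parent_in_subtree:
  assumes "c \<in> subtree T q" "c \<noteq> q" "c \<in> children T p"
  shows "p \<in> subtree T q"
proof -
  have "q \<rightarrow>\<^sup>* c" using assms(1) by (simp add: subtree_def)
  then have "c = q \<or> (\<exists>p. q \<rightarrow>\<^sup>* p \<and> p \<rightarrow> c)"
    by (cases rule: reachable_induct) auto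
  then show ?thesis
    using assms parent_unique by (auto simp: subtree_def children_def)
qed

text \<open>The ancestors of a vertex form a chain: going back from \<open>x\<close> towards
  \<open>v\<close>, the walk stays below \<open>w\<close> until it meets \<open>w\<close> or ends in
  \<open>v\<close>.\<close>

lemma subtree_comparable:
  assumes "x \<in> subtree T v" "x \<in> subtree T w"
  shows "v \<in> subtree T w \<or> w \<in> subtree T v"
proof -
  have "v \<rightarrow>\<^sup>* x" using assms(1) by (simp add: subtree_def)
  then show ?thesis using assms(2)
  proof (induction rule: reachable_induct)
    case base
    then show ?case by simp
  next
    case (step p y)
    show ?case
    proof (cases "y = w")
      case True
      then show ?thesis using step by (auto simp: subtree_def intro: reachable_adj_trans)
    next
      case False
      then show ?thesis
        using step parent_in_subtree by (auto simp: children_def)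
    qed
  qed
qed

text \<open>If the subtrees met, one sibling would lie below the other, and then so would their
  common parent.\<close>

lemma siblings_disjoint:
  assumes "v \<in> children T u" "w \<in> children T u" "x \<in> subtree T v" "x \<in> subtree T w"
  shows "v = w"
proof (rule ccontr)
  assume "v \<noteq> w"
  then have "u \<in> subtree T v \<or> u \<in> subtree T w"
    using subtree_comparable[OF assms(3,4)] parent_in_subtree assms(1,2) by metis
  then show False using not_in_child_subtree assms(1,2) by blast
qed

lemma subtree_unfold:
  assumes "u \<in> verts T"
  shows "subtree T u = insert u (\<Union>v\<in>children T u. subtree T v)"
proof
  show "subtree T u \<subseteq> insert u (\<Union>v\<in>children T u. subtree T v)"
    by (auto simp: subtree_def children_def elim: converse_reachable_cases)
  show "insert u (\<Union>v\<in>children T u. subtree T v) \<subseteq> subtree T u"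
    using self_in_subtree[OF assms] subtree_child_subset by auto
qed

lemma card_Union_child_subtrees:
  assumes "C \<subseteq> children T u"
  shows "card (\<Union>v\<in>C. subtree T v) = (\<Sum>v\<in>C. card (subtree T v))"
proof (rule card_UN_disjoint)
  show "finite C" using assms finite_children by (rule finite_subset)
  show "\<forall>v\<in>C. finite (subtree T v)" by simp
  show "\<forall>v\<in>C. \<forall>w\<in>C. v \<noteq> w \<longrightarrow> subtree T v \<inter> subtree T w = {}"
    using assms siblings_disjoint by (meson disjoint_iff subsetD)
qed

lemma card_subtree_unfold:
  assumes "u \<in> verts T"
  shows "card (subtree T u) = Suc (\<Sum>v\<in>children T u. card (subtree T v))"
proof -
  have "u \<notin> (\<Union>v\<in>children T u. subtree T v)"
    using not_in_child_subtree by blast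
  then show ?thesis
    unfolding subtree_unfold[OF assms]
    by (subst card_insert_disjoint) (auto simp: card_Union_child_subtrees[OF subset_refl])
qed

section \<open>Projectivity as convexity of all subtrees\<close>

lemma convex_subtreesD:
  assumes "convex_subtrees T \<pi>" "x \<in> subtree T u" "z \<in> subtree T u" "y \<in> verts T"
    "\<pi> x < \<pi> y" "\<pi> y < \<pi> z"
  shows "y \<in> subtree T u"
proof -
  have "u \<in> verts T" using assms(2) by (auto simp: subtree_def elim: reachable_in_vertsE)
  then show ?thesis using assms unfolding convex_subtrees_def by blast
qed

text \<open>No edge of the subtree passes over an outside vertex \<open>y\<close>. Both ends of each
  edge are therefore on the same side of \<open>y\<close>, and connectedness puts the whole subtree
  on that side.\<close>

lemma projective_convex_subtrees:
  assumes "projective T r \<pi>"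
  shows "convex_subtrees T \<pi>"
  unfolding convex_subtrees_def
proof (intro ballI impI, rule ccontr)
  fix u x z y
  assume u: "u \<in> verts T" and xz: "x \<in> subtree T u" "z \<in> subtree T u" and y: "y \<in> verts T"
    and between: "\<pi> x < \<pi> y" "\<pi> y < \<pi> z" and out: "y \<notin> subtree T u"
  note proj = assms[unfolded projective_def planar_def]
  have neq: "\<pi> a \<noteq> \<pi> b" if "a \<in> subtree T u" "b \<in> verts T" "b \<notin> subtree T u" for a b
    using that subtree_subset_verts[of u]
      linear_arrangement_eq_iff[OF projective_linear_arrangement[OF assms], of a b] by auto
  have nocross: "\<not> (\<pi> a < \<pi> c \<and> \<pi> c < \<pi> b \<and> \<pi> b < \<pi> d)"
    if "adjacent T a b" "adjacent T c d" for a b c d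
    using proj[THEN conjunct1, THEN conjunct2] that by blast
  have nocover: "\<not> (\<pi> a < \<pi> r \<and> \<pi> r < \<pi> b)" if "adjacent T a b" for a b
    using proj[THEN conjunct2] that unfolding covers_def by blast
  have no_edge_over: "\<not> (\<pi> s < \<pi> y \<and> \<pi> y < \<pi> t)" if st: "adjacent T s t" "s \<in> subtree T u" "t \<in> subtree T u" for s t
  proof -
    have "r \<rightarrow>\<^sup>* y" using y subtree_root by (auto simp: subtree_def)
    \<comment> \<open>Invariant along the walk from the root to \<open>y\<close>: the root is not
      covered, and as long as the walk stays outside the subtree, it can get under the edge between
      \<open>s\<close> and \<open>t\<close> only by crossing it.\<close>
    then have "y \<in> subtree T u \<or> \<not> (\<pi> s < \<pi> y \<and> \<pi> y < \<pi> t)"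
    proof (induction rule: reachable_induct)
      case base
      then show ?case using nocover[OF st(1)] by simp
    next
      case (step a b)
      show ?case
      proof (rule ccontr)
        assume neg: "\<not> ?thesis"
        have ab: "a \<in> verts T" "a \<notin> subtree T u"
          using neg step.hyps subtree_child by (auto simp: children_def dest: adj_in_verts)
        have "\<pi> a \<noteq> \<pi> s" "\<pi> a \<noteq> \<pi> t"
          using ab neq[OF st(2)] neq[OF st(3)] by metis+
        moreover have "\<pi> s < \<pi> b" "\<pi> b < \<pi> t" using neg by auto
        moreover have "adjacent T a b" "adjacent T b a"
          using step.hyps by (auto simp: adjacent_def)
        ultimately show False
          using step.IH ab nocross[of a b s t] nocross[of s t b a] st(1) by auto
      qed
    qed
    then show ?thesis using out by simp
  qed
  have edge: "(\<pi> s < \<pi> y) = (\<pi> t < \<pi> y)"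
    if "s \<rightarrow> t" "s \<in> subtree T u" for s t
  proof -
    have "t \<in> subtree T u" using that subtree_child by (auto simp: children_def)
    moreover have "\<pi> s \<noteq> \<pi> y" "\<pi> t \<noteq> \<pi> y"
      using neq[OF that(2) y out] neq[OF calculation y out] by simp_all
    ultimately show ?thesis
      using no_edge_over[of s t] no_edge_over[of t s] that
      by (auto simp: adjacent_def)
  qed
  have "(\<pi> w < \<pi> y) = (\<pi> u < \<pi> y)" if "w \<in> subtree T u" for w
  proof -
    have "u \<rightarrow>\<^sup>* w" using that by (simp add: subtree_def)
    then show ?thesis
      by (induction rule: reachable_induct) (use edge in \<open>auto simp: subtree_def\<close>)
  qed
  from this[OF xz(1)] this[OF xz(2)] show False using between by simp
qed

text \<open>
  Of two arcs without a common endpoint, one has both endpoints in the subtree of its tail and that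
  subtree contains no endpoint of the other, so convexity excludes a crossing.
\<close>

lemma convex_subtrees_projective:
  assumes "linear_arrangement T \<pi>" and convex: "convex_subtrees T \<pi>"
  shows "projective T r \<pi>"
proof -
  have no_cross: "\<not> (\<pi> s < \<pi> u \<and> \<pi> u < \<pi> t \<and> \<pi> t < \<pi> v)"
    if st: "adjacent T s t" and uv: "adjacent T u v" for s t u v
  proof
    assume cross: "\<pi> s < \<pi> u \<and> \<pi> u < \<pi> t \<and> \<pi> t < \<pi> v"
    obtain p c where pc: "c \<in> children T p" "s = p \<and> t = c \<or> s = c \<and> t = p"
      using st by (auto simp: adjacent_def children_def)
    obtain q d where qd: "d \<in> children T q" "u = q \<and> v = d \<or> u = d \<and> v = q"
      using uv by (auto simp: adjacent_def children_def)
    have sub: "p \<in> subtree T p" "c \<in> subtree T p" "q \<in> subtree T q" "d \<in> subtree T q"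
      using pc(1) qd(1) by (auto simp: subtree_def children_def dest: adj_in_verts)
    have verts: "s \<in> verts T" "t \<in> verts T" "u \<in> verts T" "v \<in> verts T"
      using st uv by (auto simp: adjacent_def dest: adj_in_verts)
    have distinct: "p \<noteq> q" "c \<noteq> q" "d \<noteq> p" using cross pc(2) qd(2) by auto
    have "p \<notin> subtree T q \<and> c \<notin> subtree T q \<or> q \<notin> subtree T p \<and> d \<notin> subtree T p"
      using parent_in_subtree[of c q p] parent_in_subtree[of d p q] subtree_antisym[of p q]
        pc(1) qd(1) distinct by blast
    then have "u \<notin> subtree T p \<and> v \<notin> subtree T p \<and> s \<in> subtree T p \<and> t \<in> subtree T p \<or>
      s \<notin> subtree T q \<and> t \<notin> subtree T q \<and> u \<in> subtree T q \<and> v \<in> subtree T q"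
      using pc(2) qd(2) sub by blast
    then show False
      using convex_subtreesD[OF convex, of s p t u] convex_subtreesD[OF convex, of u q v t] verts cross
      by blast
  qed
  have no_cover: "\<not> covers \<pi> u v r" if uv: "adjacent T u v" for u v
  proof
    assume cov: "covers \<pi> u v r"
    obtain p c where pc: "c \<in> children T p" "u = p \<and> v = c \<or> u = c \<and> v = p"
      using uv by (auto simp: adjacent_def children_def)
    have sub: "p \<in> subtree T p" "c \<in> subtree T p" "p \<in> subtree T r"
      using pc(1) subtree_root by (auto simp: subtree_def children_def dest: adj_in_verts)
    then have "u \<in> subtree T p" "v \<in> subtree T p"
      using pc(2) by auto
    \<comment> \<open>With the root below \<open>p\<close>, \<open>p\<close> is the root itself, but
      an edge does not cover its own endpoint.\<close>
    then have "r \<in> subtree T p"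
      using convex_subtreesD[OF convex, of u p v r] cov root_in_verts by (simp add: covers_def)
    then have "p = r" using sub subtree_antisym by blast
    then show False using cov pc(2) by (auto simp: covers_def)
  qed
  show ?thesis
    using assms(1) no_cross no_cover unfolding projective_def planar_def by blast
qed

section \<open>Edge lengths bounded by sizes of sibling subtrees\<close>

lemma cost_conv_children: "cost T \<pi> = (\<Sum>u\<in>verts T. \<Sum>v\<in>children T u. pos_dist \<pi> u v)"
proof -
  \<comment> \<open>In the absence of parallel arcs, arcs correspond to parent-child pairs; grouping
    by the parent makes the cost a sum of local terms.\<close>
  have "cost T \<pi> = (\<Sum>(u, v)\<in>arcs_ends T. pos_dist \<pi> u v)"
    unfolding cost_def arcs_ends_def
    by (subst sum.reindex[OF inj_on_arc_to_ends]) (simp add: arc_to_ends_def)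
  also have "arcs_ends T = Sigma (verts T) (children T)"
    by (auto simp: children_def dest: adj_in_verts)
  finally show ?thesis by (simp add: sum.Sigma)
qed

lemma card_segment:
  assumes "linear_arrangement T \<pi>" "u \<in> verts T" "v \<in> verts T"
  shows "int (card (segment T \<pi> u v)) = pos_dist \<pi> u v"
proof -
  have bij: "inj_on \<pi> (verts T)" "\<pi> ` verts T = {1..card (verts T)}"
    using assms(1) by (auto simp: linear_arrangement_def bij_betw_def)
  let ?I = "if \<pi> u \<le> \<pi> v then {\<pi> u<..\<pi> v} else {\<pi> v..<\<pi> u}"
  have "\<pi> u \<in> \<pi> ` verts T" "\<pi> v \<in> \<pi> ` verts T" using assms by auto
  \<comment> \<open>Every position between those of \<open>u\<close> and \<open>v\<close> is
    occupied.\<close>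
  then have "?I \<subseteq> \<pi> ` verts T" unfolding bij(2) by auto
  then have image: "\<pi> ` segment T \<pi> u v = ?I" by (auto simp: segment_def)
  have "inj_on \<pi> (segment T \<pi> u v)"
    by (rule inj_on_subset[OF bij(1)]) (auto simp: segment_def)
  then have "card (segment T \<pi> u v) = card ?I"
    unfolding image[symmetric] by (rule card_image[symmetric])
  then show ?thesis by (auto simp: pos_dist_def)
qed

lemma child_in_segment:
  assumes "linear_arrangement T \<pi>" "v \<in> children T u"
  shows "v \<in> segment T \<pi> u v"
proof -
  have "v \<in> verts T" and "u \<in> verts T" "u \<noteq> v"
    using assms(2) adj_not_same by (auto simp: children_def dest: adj_in_verts)
  then have "\<pi> u \<noteq> \<pi> v" using linear_arrangement_eq_iff[OF assms(1)] by simp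
  then show ?thesis using \<open>v \<in> verts T\<close> by (auto simp: segment_def)
qed

text \<open>Convexity of the subtree of \<open>u\<close> places \<open>x\<close> in some child
  block. That block is convex too and contains neither \<open>u\<close> nor, unless
  \<open>z = v\<close>, the vertex \<open>v\<close>, so its root \<open>z\<close> is on the same
  side of both as \<open>x\<close>.\<close>

lemma segment_subset_sibling_subtrees:
  assumes lin: "linear_arrangement T \<pi>" and convex: "convex_subtrees T \<pi>"
    and v: "v \<in> children T u"
  shows "segment T \<pi> u v \<subseteq> (\<Union>z\<in>children T u \<inter> segment T \<pi> u v. subtree T z)"
proof
  fix x assume x: "x \<in> segment T \<pi> u v"
  have uv: "u \<in> verts T" "v \<in> verts T"
    using v by (auto simp: children_def dest: adj_in_verts)
  have sub: "u \<in> subtree T u" "v \<in> subtree T u"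
    using self_in_subtree uv subtree_child v by auto
  have inj: "\<pi> a = \<pi> b \<longleftrightarrow> a = b" if "a \<in> verts T" "b \<in> verts T" for a b
    by (rule linear_arrangement_eq_iff[OF lin that])
  have xv: "x \<in> verts T" and "x \<noteq> u" using x by (auto simp: segment_def)
  show "x \<in> (\<Union>z\<in>children T u \<inter> segment T \<pi> u v. subtree T z)"
  proof (cases "x = v")
    case True
    then show ?thesis using v x child_in_own_subtree by blast
  next
    case False
    then have strict: "\<pi> u < \<pi> x \<and> \<pi> x < \<pi> v \<or> \<pi> v < \<pi> x \<and> \<pi> x < \<pi> u"
      using x inj[OF xv uv(2)] by (auto simp: segment_def)
    then have "x \<in> subtree T u"
      using convex_subtreesD[OF convex sub xv] convex_subtreesD[OF convex sub(2,1) xv] by blast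
    then obtain z where z: "z \<in> children T u" "x \<in> subtree T z"
      using subtree_unfold[OF uv(1)] \<open>x \<noteq> u\<close> by auto
    have zz: "z \<in> subtree T z" "z \<in> verts T" "u \<notin> subtree T z" "z \<noteq> u"
      using child_in_own_subtree[OF z(1)] not_in_child_subtree[OF z(1)] subtree_subset_verts by auto
    have "z \<in> segment T \<pi> u v"
    proof (cases "z = v")
      case True
      then show ?thesis using child_in_segment[OF lin v] by simp
    next
      case False
      then have "v \<notin> subtree T z"
        using siblings_disjoint[OF v z(1)] child_in_own_subtree[OF v] by blast
      then have "\<not> (\<pi> x < \<pi> v \<and> \<pi> v < \<pi> z)" "\<not> (\<pi> z < \<pi> v \<and> \<pi> v < \<pi> x)"
        "\<not> (\<pi> x < \<pi> u \<and> \<pi> u < \<pi> z)" "\<not> (\<pi> z < \<pi> u \<and> \<pi> u < \<pi> x)"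
        using convex_subtreesD[OF convex z(2) zz(1)] convex_subtreesD[OF convex zz(1) z(2)]
          uv zz(3) by blast+
      moreover have "\<pi> z \<noteq> \<pi> v" "\<pi> z \<noteq> \<pi> u"
        using inj uv zz(2,4) False by auto
      ultimately show ?thesis using strict zz(2) by (auto simp: segment_def)
    qed
    then show ?thesis using z by blast
  qed
qed

lemma sum_segment_conv:
  "(\<Sum>z\<in>children T u. if z \<in> segment T \<pi> u v then card (subtree T z) else 0) =
    card (\<Union>z\<in>children T u \<inter> segment T \<pi> u v. subtree T z)"
  by (subst card_Union_child_subtrees) (auto simp: sum.inter_restrict)

lemma pos_dist_le_sum_segment:
  assumes "linear_arrangement T \<pi>" "convex_subtrees T \<pi>" "v \<in> children T u"
  shows "pos_dist \<pi> u v \<le>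
    int (\<Sum>z\<in>children T u. if z \<in> segment T \<pi> u v then card (subtree T z) else 0)"
proof -
  have uv: "u \<in> verts T" "v \<in> verts T"
    using assms(3) by (auto simp: children_def dest: adj_in_verts)
  have "card (segment T \<pi> u v) \<le> card (\<Union>z\<in>children T u \<inter> segment T \<pi> u v. subtree T z)"
    by (rule card_mono[OF _ segment_subset_sibling_subtrees[OF assms]]) simp
  then show ?thesis
    unfolding sum_segment_conv card_segment[OF assms(1) uv, symmetric] by simp
qed

text \<open>By cardinality, the segment equals the union of the blocks covering it. The block of
  \<open>v\<close> is one of them, so it does not extend beyond \<open>v\<close>.\<close>

lemma subtree_subset_segment_if_tight:
  assumes "linear_arrangement T \<pi>" "convex_subtrees T \<pi>" "v \<in> children T u"
    and "pos_dist \<pi> u v =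
      int (\<Sum>z\<in>children T u. if z \<in> segment T \<pi> u v then card (subtree T z) else 0)"
  shows "subtree T v \<subseteq> segment T \<pi> u v"
proof -
  have uv: "u \<in> verts T" "v \<in> verts T"
    using assms(3) by (auto simp: children_def dest: adj_in_verts)
  have "card (segment T \<pi> u v) = card (\<Union>z\<in>children T u \<inter> segment T \<pi> u v. subtree T z)"
    using assms(4) unfolding sum_segment_conv card_segment[OF assms(1) uv, symmetric] by simp
  then have "segment T \<pi> u v = (\<Union>z\<in>children T u \<inter> segment T \<pi> u v. subtree T z)"
    by (intro card_subset_eq segment_subset_sibling_subtrees assms) simp_all
  then show ?thesis using child_in_segment[OF assms(1,3)] assms(3) by blast
qed

section \<open>Pairwise comparison of siblings and the local cost bound\<close>

lemma precedes_asym: "precedes T g z v \<Longrightarrow> \<not> precedes T g v z"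
  unfolding precedes_def by linarith

lemma precedes_trans: "precedes T g z v \<Longrightarrow> precedes T g v w \<Longrightarrow> precedes T g z w"
  unfolding precedes_def by linarith

lemma precedes_trichotomy:
  assumes "inj_on g (verts T)" "v \<in> verts T" "z \<in> verts T" "v \<noteq> z"
  shows "precedes T g v z \<longleftrightarrow> \<not> precedes T g z v"
  using inj_on_eq_iff[OF assms(1-3)] assms(4) by (auto simp: precedes_def)

lemma segment_asym:
  assumes "linear_arrangement T \<pi>" "v \<in> segment T \<pi> u z" "z \<in> segment T \<pi> u v"
  shows "v = z"
proof -
  have "\<pi> v = \<pi> z" "v \<in> verts T" "z \<in> verts T" using assms(2,3) by (auto simp: segment_def)
  then show ?thesis
    using linear_arrangement_eq_iff[OF assms(1)] by simp
qed

text \<open>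
  Of two siblings, at most one lies between the parent and the other, so together they contribute at
  most the larger of their sizes, which is what the order by decreasing size achieves.
\<close>

lemma sibling_pair_le:
  assumes "inj_on g (verts T)" "linear_arrangement T \<pi>" "v \<in> children T u" "z \<in> children T u"
  shows "(if z \<in> segment T \<pi> u v then card (subtree T z) else 0) +
      (if v \<in> segment T \<pi> u z then card (subtree T v) else 0)
    \<le> (if z = v \<or> precedes T g z v then card (subtree T z) else 0) +
      (if v = z \<or> precedes T g v z then card (subtree T v) else 0)"
proof (cases "z = v")
  case False
  have "v \<in> verts T" "z \<in> verts T" using assms children_subset_verts by auto
  then show ?thesis
    using precedes_trichotomy[OF assms(1), of v z] segment_asym[OF assms(2), of v u z] False
    by (auto simp: precedes_def)
qed simp

text \<open>The right-hand side is the larger of the two sizes and is positive. At most one summand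
  on the left is nonzero, so exactly one is, and it is the larger size.\<close>

lemma sibling_pair_tight:
  assumes "inj_on g (verts T)" "linear_arrangement T \<pi>" "v \<in> children T u" "z \<in> children T u"
    and "z \<noteq> v"
    and "(if z \<in> segment T \<pi> u v then card (subtree T z) else 0) +
      (if v \<in> segment T \<pi> u z then card (subtree T v) else 0)
    = (if z = v \<or> precedes T g z v then card (subtree T z) else 0) +
      (if v = z \<or> precedes T g v z then card (subtree T v) else 0)"
  shows "z \<in> segment T \<pi> u v \<and> card (subtree T v) \<le> card (subtree T z) \<or>
    v \<in> segment T \<pi> u z \<and> card (subtree T z) \<le> card (subtree T v)"
proof -
  have verts: "v \<in> verts T" "z \<in> verts T" using assms children_subset_verts by auto
  then have "0 < card (subtree T v)" "0 < card (subtree T z)" using card_subtree_pos by auto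
  then show ?thesis
    using precedes_trichotomy[OF assms(1) verts] segment_asym[OF assms(2), of v u z] assms(5,6)
    by (auto simp: precedes_def split: if_splits)
qed

text \<open>Only the sum is bounded: a single edge can exceed its \<open>stacked_size\<close>, for
  instance when the largest of several blocks on one side is outermost.\<close>

lemma sum_pos_dist_le:
  assumes "inj_on g (verts T)" "linear_arrangement T \<pi>" "convex_subtrees T \<pi>"
  shows "(\<Sum>v\<in>children T u. pos_dist \<pi> u v) \<le> (\<Sum>v\<in>children T u. int (stacked_size T g u v))"
proof -
  have "(\<Sum>v\<in>children T u. pos_dist \<pi> u v) \<le> (\<Sum>v\<in>children T u.
      int (\<Sum>z\<in>children T u. if z \<in> segment T \<pi> u v then card (subtree T z) else 0))"
    by (intro sum_mono pos_dist_le_sum_segment assms)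
  also have "\<dots> = int (\<Sum>v\<in>children T u.
      \<Sum>z\<in>children T u. if z \<in> segment T \<pi> u v then card (subtree T z) else 0)"
    by simp
  also have "\<dots> \<le> int (\<Sum>v\<in>children T u. stacked_size T g u v)"
    unfolding stacked_size_def of_nat_le_iff
    by (rule sum_pairs_le_if_symmetrized_le) (rule sibling_pair_le[OF assms(1,2)])
  finally show ?thesis by simp
qed

text \<open>The sum of sibling sizes over segments is squeezed between the two sides of
  \<open>eq\<close>. Tightness of the edge bound gives the first claim, tightness of the pairwise
  comparison the second.\<close>

lemma sum_pos_dist_tight:
  assumes "inj_on g (verts T)" "linear_arrangement T \<pi>" "convex_subtrees T \<pi>"
    and eq: "(\<Sum>v\<in>children T u. pos_dist \<pi> u v) = (\<Sum>v\<in>children T u. int (stacked_size T g u v))"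
    and v: "v \<in> children T u"
  shows "subtree T v \<subseteq> segment T \<pi> u v"
    and "z \<in> children T u \<Longrightarrow> z \<noteq> v \<Longrightarrow>
      z \<in> segment T \<pi> u v \<and> card (subtree T v) \<le> card (subtree T z) \<or>
      v \<in> segment T \<pi> u z \<and> card (subtree T z) \<le> card (subtree T v)"
proof -
  let ?a = "\<lambda>v z. if z \<in> segment T \<pi> u v then card (subtree T z) else 0"
  let ?b = "\<lambda>v z. if z = v \<or> precedes T g z v then card (subtree T z) else 0"
  have le: "pos_dist \<pi> u v \<le> int (\<Sum>z\<in>children T u. ?a v z)" if "v \<in> children T u" for v
    by (intro pos_dist_le_sum_segment assms that)
  have le2: "(\<Sum>v\<in>children T u. \<Sum>z\<in>children T u. ?a v z) \<le>
      (\<Sum>v\<in>children T u. \<Sum>z\<in>children T u. ?b v z)"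
    by (rule sum_pairs_le_if_symmetrized_le) (rule sibling_pair_le[OF assms(1,2)])
  have le1: "(\<Sum>v\<in>children T u. pos_dist \<pi> u v) \<le>
      (\<Sum>v\<in>children T u. int (\<Sum>z\<in>children T u. ?a v z))"
    by (intro sum_mono le)
  have eq': "(\<Sum>v\<in>children T u. pos_dist \<pi> u v) =
      int (\<Sum>v\<in>children T u. \<Sum>z\<in>children T u. ?b v z)"
    unfolding eq stacked_size_def by (rule of_nat_sum[symmetric])
  have eqs: "(\<Sum>v\<in>children T u. pos_dist \<pi> u v) =
      (\<Sum>v\<in>children T u. int (\<Sum>z\<in>children T u. ?a v z))"
    "(\<Sum>v\<in>children T u. \<Sum>z\<in>children T u. ?a v z) =
      (\<Sum>v\<in>children T u. \<Sum>z\<in>children T u. ?b v z)"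
    using le1 le2 unfolding eq' of_nat_sum[symmetric] of_nat_le_iff of_nat_eq_iff by auto
  have "pos_dist \<pi> u v = int (\<Sum>z\<in>children T u. ?a v z)"
    by (rule sum_mono_inv[OF eqs(1) le v finite_children])
  then show "subtree T v \<subseteq> segment T \<pi> u v"
    by (rule subtree_subset_segment_if_tight[OF assms(2,3) v])
  assume z: "z \<in> children T u" "z \<noteq> v"
  have "?a v z + ?a z v = ?b v z + ?b z v"
    by (rule symmetrized_eq_if_sum_pairs_eq[OF finite_children _ eqs(2) v z(1)])
      (rule sibling_pair_le[OF assms(1,2)])
  then show "z \<in> segment T \<pi> u v \<and> card (subtree T v) \<le> card (subtree T z) \<or>
      v \<in> segment T \<pi> u z \<and> card (subtree T z) \<le> card (subtree T v)"
    by (rule sibling_pair_tight[OF assms(1,2) v z])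
qed

section \<open>An arrangement attaining the bound\<close>

lemma stacked_size_less:
  assumes "u \<in> verts T"
  shows "stacked_size T g u v < card (subtree T u)"
proof -
  have "stacked_size T g u v \<le> (\<Sum>z\<in>children T u. card (subtree T z))"
    unfolding stacked_size_def by (rule sum_mono) simp
  then show ?thesis by (simp add: card_subtree_unfold[OF assms])
qed

lemma card_subtree_le_stacked_size:
  assumes "v \<in> children T u"
  shows "card (subtree T v) \<le> stacked_size T g u v"
  using member_le_sum[of v "children T u" "\<lambda>z. if z = v \<or> precedes T g z v then card (subtree T z) else 0"]
    assms by (simp add: stacked_size_def)

text \<open>All blocks counted for \<open>z\<close> are also counted for \<open>v\<close>, and the
  block of \<open>v\<close> comes on top. Hence stacked blocks do not overlap.\<close>

lemma stacked_size_add_le: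
  assumes "z \<in> children T u" "v \<in> children T u" "precedes T g z v"
  shows "stacked_size T g u z + card (subtree T v) \<le> stacked_size T g u v"
proof -
  have "(\<Sum>w\<in>children T u. if w = v then card (subtree T w) else 0) = card (subtree T v)"
    using assms(2) by simp
  then have "stacked_size T g u z + card (subtree T v) = (\<Sum>w\<in>children T u.
      (if w = z \<or> precedes T g w z then card (subtree T w) else 0) +
      (if w = v then card (subtree T w) else 0))"
    by (simp only: stacked_size_def sum.distrib)
  also have "\<dots> \<le> stacked_size T g u v"
    unfolding stacked_size_def
  proof (rule sum_mono)
    fix w
    have "\<not> (v = z \<or> precedes T g v z)" "w = z \<or> precedes T g w z \<Longrightarrow> precedes T g w v"
      using assms(3) precedes_trans precedes_asym by metis+
    then show "(if w = z \<or> precedes T g w z then card (subtree T w) else 0) +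
        (if w = v then card (subtree T w) else 0) \<le>
      (if w = v \<or> precedes T g w v then card (subtree T w) else 0)"
      by (cases "w = v") simp_all
  qed
  finally show ?thesis .
qed

text \<open>
  The child blocks are stacked to the right of \<open>u\<close> by decreasing size, each of them reflected, so that
  every child sits at the end of its block that is farthest from \<open>u\<close>.
\<close>

lemma extremal_layout_exists:
  assumes g: "inj_on g (verts T)" and "u \<in> verts T"
  shows "\<exists>f. extremal_layout T g u f"
  using assms(2)
proof (induction "card (subtree T u)" arbitrary: u rule: less_induct)
  case less
  note u = less.prems
  have "\<exists>f. extremal_layout T g v f" if v: "v \<in> children T u" for v
  proof (rule less.hyps)
    show "v \<in> verts T" using v children_subset_verts by auto
    show "card (subtree T v) < card (subtree T u)"
      using subtree_child_subset[OF v] not_in_child_subtree[OF v] self_in_subtree[OF u]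
      by (intro psubset_card_mono) auto
  qed
  then obtain F where F: "\<And>v. v \<in> children T u \<Longrightarrow> extremal_layout T g v (F v)"
    by metis
  have "\<exists>v. v \<in> children T u \<and> x \<in> subtree T v" if "x \<in> subtree T u" "x \<noteq> u" for x
    using that subtree_unfold[OF u] by auto
  \<comment> \<open>\<open>br x\<close> is the child of \<open>u\<close> whose block contains
    \<open>x\<close>.\<close>
  then obtain br where br: "\<And>x. x \<in> subtree T u \<Longrightarrow> x \<noteq> u \<Longrightarrow> br x \<in> children T u \<and> x \<in> subtree T (br x)"
    by metis
  define top where "top v = int (stacked_size T g u v)" for v
  define size where "size v = int (card (subtree T v))" for v
  \<comment> \<open>Subtracting \<open>F\<close> reflects the block: \<open>v\<close> has offset 0
    in its own layout and so lands on \<open>top v\<close>, the end of its block farthest from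
    \<open>u\<close>.\<close>
  define f where "f x = (if x = u then 0 else top (br x) - F (br x) x)" for x
  have f_root: "f u = 0" by (simp add: f_def)
  have f_block: "f x = top v - F v x" if "v \<in> children T u" "x \<in> subtree T v" for v x
  proof -
    have "x \<noteq> u" "x \<in> subtree T u"
      using that not_in_child_subtree[OF that(1)] subtree_child_subset[OF that(1)] by auto
    moreover from this have "br x = v" using br siblings_disjoint that by blast
    ultimately show ?thesis by (simp add: f_def)
  qed
  have F_range: "0 \<le> F v x \<and> F v x < size v" if "v \<in> children T u" "x \<in> subtree T v" for v x
    using F[OF that(1)] that(2) by (auto simp: extremal_layout_def size_def)
  have range: "top v - size v < f x \<and> f x \<le> top v" if "v \<in> children T u" "x \<in> subtree T v" for v x
    using F_range[OF that] f_block[OF that] by simp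
  have top: "size v \<le> top v" "top v < size u" if "v \<in> children T u" for v
    using card_subtree_le_stacked_size[OF that, of g] stacked_size_less[OF u, of g v]
    by (auto simp: top_def size_def)
  have sep: "top v \<le> top w - size w \<or> top w \<le> top v - size v"
    if "v \<in> children T u" "w \<in> children T u" "v \<noteq> w" for v w
  proof -
    have "precedes T g v w \<or> precedes T g w v"
      using precedes_trichotomy[OF g, of v w] that children_subset_verts by blast
    then show ?thesis
      using stacked_size_add_le[OF that(1,2), of g] stacked_size_add_le[OF that(2,1), of g]
      by (auto simp: top_def size_def)
  qed
  \<comment> \<open>The half-open ranges of the blocks are disjoint and none contains 0, so an
    offset determines its block. Injectivity and convexity reduce to single blocks in this
    way.\<close>
  have locate: "y \<in> subtree T v"
    if y: "y \<in> subtree T u" and v: "v \<in> children T u" and "top v - size v < f y" "f y \<le> top v" for y v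
  proof -
    have "y \<noteq> u" using that(3) top(1)[OF v] f_root by auto
    then have b: "br y \<in> children T u" "y \<in> subtree T (br y)" using br[OF y] by auto
    have "br y = v"
      using range[OF b] sep[OF b(1) v] that(3,4) by auto
    then show ?thesis using b by simp
  qed
  have f_pos: "0 < f x" if "x \<in> subtree T u" "x \<noteq> u" for x
    using range[of "br x" x] br[OF that] top(1)[of "br x"] by auto
  have "inj_on f (subtree T u)"
  proof (rule inj_onI)
    fix x y assume xy: "x \<in> subtree T u" "y \<in> subtree T u" "f x = f y"
    show "x = y"
    proof (cases "x = u")
      case True
      then show ?thesis using f_pos[OF xy(2)] f_root xy(3) by auto
    next
      case False
      then have b: "br x \<in> children T u" "x \<in> subtree T (br x)" using br[OF xy(1)] by auto
      have y: "y \<in> subtree T (br x)"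
        using locate[OF xy(2) b(1)] range[OF b] xy(3) by simp
      have "F (br x) x = F (br x) y"
        using f_block[OF b] f_block[OF b(1) y] xy(3) by simp
      moreover have "inj_on (F (br x)) (subtree T (br x))"
        using F[OF b(1)] by (simp add: extremal_layout_def)
      ultimately show ?thesis using b(2) y by (simp add: inj_on_eq_iff)
    qed
  qed
  moreover have "f ` subtree T u \<subseteq> {0..<int (card (subtree T u))}"
  proof (rule image_subsetI)
    fix x assume x: "x \<in> subtree T u"
    show "f x \<in> {0..<int (card (subtree T u))}"
    proof (cases "x = u")
      case True
      then show ?thesis using f_root card_subtree_pos[OF u] by simp
    next
      case False
      then have b: "br x \<in> children T u" "x \<in> subtree T (br x)" using br[OF x] by auto
      show ?thesis
        using range[OF b] top(2)[OF b(1)] f_pos[OF x False] by (simp add: size_def)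
    qed
  qed
  moreover have "y \<in> subtree T w"
    if w: "w \<in> subtree T u" and xz: "x \<in> subtree T w" "z \<in> subtree T w" and y: "y \<in> subtree T u"
      and between: "f x < f y" "f y < f z" for w x z y
  proof (cases "w = u")
    case True
    then show ?thesis using y by simp
  next
    case False
    define v where "v = br w"
    have v: "v \<in> children T u" "w \<in> subtree T v" using br[OF w False] by (auto simp: v_def)
    have xz': "x \<in> subtree T v" "z \<in> subtree T v" using v xz subtree_trans by auto
    have y': "y \<in> subtree T v"
      using locate[OF y v(1)] range[OF v(1) xz'(1)] range[OF v(1) xz'(2)] between by simp
    \<comment> \<open>The reflection exchanges the roles of \<open>x\<close> and
      \<open>z\<close>.\<close>
    have "F v z < F v y" "F v y < F v x"
      using between f_block[OF v(1)] xz' y' by auto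
    then show ?thesis
      using F[OF v(1)] v(2) xz y' unfolding extremal_layout_def by blast
  qed
  moreover have "\<bar>f w - f c\<bar> = int (stacked_size T g w c)"
    if w: "w \<in> subtree T u" and c: "c \<in> children T w" for w c
  proof (cases "w = u")
    case True
    have "F c c = 0" using F[of c] c True by (simp add: extremal_layout_def)
    then show ?thesis
      using f_block[of c c] child_in_own_subtree[OF c] c True f_root by (simp add: top_def)
  next
    case False
    define v where "v = br w"
    have v: "v \<in> children T u" "w \<in> subtree T v" using br[OF w False] by (auto simp: v_def)
    have "c \<in> subtree T v" using subtree_child[OF v(2) c] .
    \<comment> \<open>Within a block, shift and reflection preserve edge lengths.\<close>
    then have "\<bar>f w - f c\<bar> = \<bar>F v w - F v c\<bar>"
      using f_block[OF v] f_block[OF v(1), of c] by simp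
    then show ?thesis
      using F[OF v(1)] v(2) c by (simp add: extremal_layout_def)
  qed
  ultimately have "extremal_layout T g u f"
    using f_root unfolding extremal_layout_def by blast
  then show ?case by blast
qed

lemma extremal_arrangement_exists:
  assumes "inj_on g (verts T)"
  obtains \<pi> where "projective T r \<pi>"
    and "cost T \<pi> = (\<Sum>u\<in>verts T. \<Sum>v\<in>children T u. int (stacked_size T g u v))"
proof -
  obtain f where f: "extremal_layout T g r f"
    using extremal_layout_exists[OF assms root_in_verts] by blast
  \<comment> \<open>Offsets start at 0, positions at 1.\<close>
  define \<pi> where "\<pi> x = Suc (nat (f x))" for x
  have inj: "inj_on f (verts T)" and range: "f ` verts T \<subseteq> {0..<int (card (verts T))}"
    using f by (auto simp: extremal_layout_def subtree_root)
  then have f_nonneg: "0 \<le> f x" if "x \<in> verts T" for x using that by auto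
  have int_\<pi>: "int (\<pi> x) = f x + 1" if "x \<in> verts T" for x
    using f_nonneg[OF that] by (simp add: \<pi>_def)
  have "inj_on \<pi> (verts T)"
    using inj int_\<pi> by (metis (no_types, lifting) add_right_cancel inj_on_def)
  moreover have "\<pi> ` verts T \<subseteq> {1..card (verts T)}"
  proof (rule image_subsetI)
    fix x assume "x \<in> verts T"
    then have "f x < int (card (verts T))" using range by auto
    then show "\<pi> x \<in> {1..card (verts T)}" using f_nonneg[OF \<open>x \<in> verts T\<close>] by (auto simp: \<pi>_def)
  qed
  ultimately have lin: "linear_arrangement T \<pi>"
    unfolding linear_arrangement_def bij_betw_def
    by (simp add: card_image card_subset_eq)
  have less: "\<pi> x < \<pi> y \<longleftrightarrow> f x < f y" if "x \<in> verts T" "y \<in> verts T" for x y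
    using int_\<pi> that by (metis add_less_cancel_right of_nat_less_iff)
  have convex: "convex_subtrees T \<pi>"
    unfolding convex_subtrees_def
  proof (intro ballI impI)
    fix u x z y
    assume *: "u \<in> verts T" "x \<in> subtree T u" "z \<in> subtree T u" "y \<in> verts T" "\<pi> x < \<pi> y" "\<pi> y < \<pi> z"
    have "x \<in> verts T" "z \<in> verts T" using * subtree_subset_verts by blast+
    then have "f x < f y" "f y < f z" using * less by auto
    then show "y \<in> subtree T u"
      using f * unfolding extremal_layout_def subtree_root by blast
  qed
  have "pos_dist \<pi> u v = int (stacked_size T g u v)" if "u \<in> verts T" "v \<in> children T u" for u v
  proof -
    have "v \<in> verts T" using that children_subset_verts by auto
    then have "pos_dist \<pi> u v = \<bar>f u - f v\<bar>" using int_\<pi> that by (simp add: pos_dist_def)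
    then show ?thesis using f that by (simp add: extremal_layout_def subtree_root)
  qed
  then have "cost T \<pi> = (\<Sum>u\<in>verts T. \<Sum>v\<in>children T u. int (stacked_size T g u v))"
    unfolding cost_conv_children by (intro sum.cong refl)
  with that convex_subtrees_projective[OF lin convex] show thesis by blast
qed

section \<open>Structure of maximum projective arrangements\<close>

lemma max_projective_sum_pos_dist:
  assumes "inj_on g (verts T)" "max_projective T r \<pi>" "u \<in> verts T"
  shows "(\<Sum>v\<in>children T u. pos_dist \<pi> u v) = (\<Sum>v\<in>children T u. int (stacked_size T g u v))"
proof -
  have proj: "projective T r \<pi>" using assms(2) by (simp add: max_projective_def)
  have lin: "linear_arrangement T \<pi>" using proj by (rule projective_linear_arrangement)
  have le: "(\<Sum>v\<in>children T u. pos_dist \<pi> u v) \<le> (\<Sum>v\<in>children T u. int (stacked_size T g u v))" for u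
    by (rule sum_pos_dist_le[OF assms(1) lin projective_convex_subtrees[OF proj]])
  \<comment> \<open>Maximality against an arrangement attaining the bound makes the totals agree,
    which turns the inequality at every vertex into an equality.\<close>
  obtain \<pi>' where "projective T r \<pi>'"
    and "cost T \<pi>' = (\<Sum>u\<in>verts T. \<Sum>v\<in>children T u. int (stacked_size T g u v))"
    using extremal_arrangement_exists[OF assms(1)] .
  then have "(\<Sum>u\<in>verts T. \<Sum>v\<in>children T u. int (stacked_size T g u v)) \<le> cost T \<pi>"
    using assms(2) by (metis max_projective_def)
  moreover have "cost T \<pi> \<le> (\<Sum>u\<in>verts T. \<Sum>v\<in>children T u. int (stacked_size T g u v))"
    unfolding cost_conv_children by (intro sum_mono le)
  ultimately have "(\<Sum>u\<in>verts T. \<Sum>v\<in>children T u. pos_dist \<pi> u v) =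
      (\<Sum>u\<in>verts T. \<Sum>v\<in>children T u. int (stacked_size T g u v))"
    unfolding cost_conv_children by simp
  then show ?thesis by (rule sum_mono_inv) (use le assms(3) in auto)
qed

lemma
  assumes "max_projective T r \<pi>" "v \<in> children T u"
  shows max_projective_subtree_in_segment: "subtree T v \<subseteq> segment T \<pi> u v"
    and max_projective_siblings: "z \<in> children T u \<Longrightarrow> z \<noteq> v \<Longrightarrow>
      z \<in> segment T \<pi> u v \<and> card (subtree T v) \<le> card (subtree T z) \<or>
      v \<in> segment T \<pi> u z \<and> card (subtree T z) \<le> card (subtree T v)"
proof -
  have proj: "projective T r \<pi>" using assms(1) by (simp add: max_projective_def)
  have lin: "linear_arrangement T \<pi>" using proj by (rule projective_linear_arrangement)
  have u: "u \<in> verts T" using assms(2) by (auto simp: children_def dest: adj_in_verts)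
  \<comment> \<open>Any injective numbering will do for breaking ties; it does not occur in the
    conclusions.\<close>
  obtain g :: "'a \<Rightarrow> nat" where g: "inj_on g (verts T)"
    using finite_imp_inj_to_nat_seg[OF finite_verts] by blast
  note tight = sum_pos_dist_tight[OF g lin projective_convex_subtrees[OF proj]
      max_projective_sum_pos_dist[OF g assms(1) u] assms(2)]
  show "subtree T v \<subseteq> segment T \<pi> u v" by (rule tight(1))
  show "z \<in> segment T \<pi> u v \<and> card (subtree T v) \<le> card (subtree T z) \<or>
      v \<in> segment T \<pi> u z \<and> card (subtree T z) \<le> card (subtree T v)"
    if "z \<in> children T u" "z \<noteq> v"
    using that by (rule tight(2))
qed

text \<open>A segment starting at \<open>u\<close> stays on one side of \<open>u\<close>. Of two
  children, one lies in the segment of the other, and each subtree lies in the segment of its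
  root.\<close>

lemma max_projective_children_on_one_side:
  assumes max: "max_projective T r \<pi>"
  shows "children_on_one_side T \<pi> u"
proof (cases "children T u = {}")
  case True
  then show ?thesis by (simp add: children_on_one_side_def)
next
  case False
  then obtain v0 where v0: "v0 \<in> children T u" by blast
  have side: "(\<pi> w < \<pi> u \<longleftrightarrow> \<pi> v < \<pi> u) \<and> (\<pi> u < \<pi> w \<longleftrightarrow> \<pi> u < \<pi> v)" if "w \<in> segment T \<pi> u v" for w v
    using that by (auto simp: segment_def)
  have v0_side: "\<pi> v0 < \<pi> u \<or> \<pi> u < \<pi> v0"
    using max_projective_subtree_in_segment[OF max v0] child_in_own_subtree[OF v0]
    by (auto simp: segment_def)
  have "(\<pi> w < \<pi> u \<longleftrightarrow> \<pi> v0 < \<pi> u) \<and> (\<pi> u < \<pi> w \<longleftrightarrow> \<pi> u < \<pi> v0)"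
    if v: "v \<in> children T u" and w: "w \<in> subtree T v" for v w
  proof -
    have "w \<in> segment T \<pi> u v" using max_projective_subtree_in_segment[OF max v] w by blast
    moreover have "v = v0 \<or> v \<in> segment T \<pi> u v0 \<or> v0 \<in> segment T \<pi> u v"
      using max_projective_siblings[OF max v0 v] by blast
    ultimately show ?thesis using side by metis
  qed
  then show ?thesis
    using v0_side unfolding children_on_one_side_def by blast
qed

text \<open>The vertex \<open>z\<close> separates the blocks: \<open>x\<close> is at most as far
  from \<open>u\<close> as \<open>z\<close>, while \<open>y\<close> is beyond \<open>z\<close>,
  because the block of \<open>v\<close> is convex and does not contain \<open>z\<close>.\<close>

lemma max_projective_subtrees_ordered:
  assumes max: "max_projective T r \<pi>" and v: "v \<in> children T u" and z: "z \<in> children T u"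
    and less: "pos_dist \<pi> u z < pos_dist \<pi> u v" and x: "x \<in> subtree T z" and y: "y \<in> subtree T v"
  shows "pos_dist \<pi> u x < pos_dist \<pi> u y"
    and "card (subtree T v) \<le> card (subtree T z)"
proof -
  have convex: "convex_subtrees T \<pi>" and lin: "linear_arrangement T \<pi>"
    using max projective_convex_subtrees projective_linear_arrangement
    by (auto simp: max_projective_def)
  have "z \<noteq> v" using less by auto
  moreover have "v \<notin> segment T \<pi> u z"
    using less by (auto simp: segment_def pos_dist_def)
  ultimately have zv: "z \<in> segment T \<pi> u v" "card (subtree T v) \<le> card (subtree T z)"
    using max_projective_siblings[OF max v z] by auto
  show "card (subtree T v) \<le> card (subtree T z)" by (fact zv)
  have x': "x \<in> segment T \<pi> u z" and y': "y \<in> segment T \<pi> u v"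
    using max_projective_subtree_in_segment[OF max v] max_projective_subtree_in_segment[OF max z] x y
    by blast+
  have "z \<notin> subtree T v"
    using siblings_disjoint[OF z v child_in_own_subtree[OF z]] \<open>z \<noteq> v\<close> by blast
  moreover have "z \<in> verts T" using z children_subset_verts by auto
  ultimately have no: "\<not> (\<pi> y < \<pi> z \<and> \<pi> z < \<pi> v)" "\<not> (\<pi> v < \<pi> z \<and> \<pi> z < \<pi> y)"
    using convex_subtreesD[OF convex y child_in_own_subtree[OF v]]
      convex_subtreesD[OF convex child_in_own_subtree[OF v] y] by blast+
  have "y \<noteq> z" using \<open>z \<notin> subtree T v\<close> y by blast
  moreover have "y \<in> verts T" using y subtree_subset_verts by blast
  ultimately have "\<pi> y \<noteq> \<pi> z"
    using linear_arrangement_eq_iff[OF lin] \<open>z \<in> verts T\<close> by simp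
  then show "pos_dist \<pi> u x < pos_dist \<pi> u y"
    using no x' y' zv(1) less by (auto simp: segment_def pos_dist_def)
qed

lemma max_projective_children_sorted_by_size:
  assumes max: "max_projective T r \<pi>"
  shows "children_sorted_by_size T \<pi> u"
proof -
  have lin: "linear_arrangement T \<pi>"
    using max projective_linear_arrangement by (auto simp: max_projective_def)
  obtain xs where xs: "set xs = children T u" "distinct xs"
    using finite_distinct_list[OF finite_children] by blast
  define vs where "vs = sort_key (pos_dist \<pi> u) xs"
  have vs: "set vs = children T u" "distinct vs" "sorted (map (pos_dist \<pi> u) vs)"
    using xs by (simp_all add: vs_def)
  \<comment> \<open>Siblings lie on the same side of \<open>u\<close>, so different positions mean
    different distances; the sorted list is thus strictly increasing.\<close>
  have dist_neq: "pos_dist \<pi> u v \<noteq> pos_dist \<pi> u z"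
    if "v \<in> children T u" "z \<in> children T u" "v \<noteq> z" for v z
  proof -
    have "v \<in> verts T" "z \<in> verts T" using that children_subset_verts by auto
    then have "\<pi> v \<noteq> \<pi> z"
      using linear_arrangement_eq_iff[OF lin] that(3) by simp
    then show ?thesis
      using max_projective_siblings[OF max that(1,2)] that(3)
      by (auto simp: segment_def pos_dist_def)
  qed
  have "sorted_wrt (\<lambda>v w. pos_dist \<pi> u v < pos_dist \<pi> u w) vs"
    unfolding sorted_wrt_iff_nth_less
  proof (intro allI impI)
    fix i j assume ij: "i < j" "j < length vs"
    have "pos_dist \<pi> u (vs ! i) \<le> pos_dist \<pi> u (vs ! j)"
      using sorted_nth_mono[OF vs(3), of i j] ij by simp
    moreover have "vs ! i \<noteq> vs ! j" using vs(2) ij by (simp add: nth_eq_iff_index_eq)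
    moreover have "vs ! i \<in> children T u" "vs ! j \<in> children T u"
      using vs(1) ij nth_mem[of i vs] nth_mem[of j vs] by auto
    ultimately show "pos_dist \<pi> u (vs ! i) < pos_dist \<pi> u (vs ! j)"
      using dist_neq[of "vs ! i" "vs ! j"] by simp
  qed
  note mono = sorted_wrt_mono_rel[OF _ this]
  have "sorted_wrt (\<lambda>v w. \<forall>x \<in> subtree T v. \<forall>y \<in> subtree T w. pos_dist \<pi> u x < pos_dist \<pi> u y) vs"
  proof (rule mono, intro ballI)
    fix v w x y
    assume vw: "v \<in> set vs" "w \<in> set vs" "pos_dist \<pi> u v < pos_dist \<pi> u w"
      and xy: "x \<in> subtree T v" "y \<in> subtree T w"
    show "pos_dist \<pi> u x < pos_dist \<pi> u y"
      by (rule max_projective_subtrees_ordered(1)[OF max vw(2,1)[unfolded vs(1)] vw(3) xy])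
  qed
  moreover have "sorted_wrt (\<lambda>v w. card (subtree T v) \<ge> card (subtree T w)) vs"
  proof (rule mono)
    fix v w
    assume vw: "v \<in> set vs" "w \<in> set vs" "pos_dist \<pi> u v < pos_dist \<pi> u w"
    note vw' = vw(2,1)[unfolded vs(1)]
    show "card (subtree T w) \<le> card (subtree T v)"
      by (rule max_projective_subtrees_ordered(2)[OF max vw' vw(3)
            child_in_own_subtree[OF vw'(2)] child_in_own_subtree[OF vw'(1)]])
  qed
  ultimately show ?thesis
    unfolding children_sorted_by_size_def using vs(1,2) by blast
qed

text \<open>The subtree of \<open>v\<close> lies between \<open>u\<close> and \<open>v\<close>,
  which makes \<open>v\<close> its vertex farthest from \<open>u\<close>; the branching of
  \<open>u\<close> tells on which side of \<open>u\<close> this happens.\<close>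

lemma max_projective_alternates:
  assumes max: "max_projective T r \<pi>" and "u \<rightarrow> v"
  shows "left_branching T \<pi> u \<Longrightarrow> right_branching T \<pi> v"
    and "right_branching T \<pi> u \<Longrightarrow> left_branching T \<pi> v"
proof -
  have v: "v \<in> children T u" "v \<in> subtree T u" using assms(2) by (auto simp: children_def subtree_def)
  have seg: "w \<in> segment T \<pi> u v" if "w \<in> subtree T v" for w
    using max_projective_subtree_in_segment[OF max v(1)] that by blast
  show "right_branching T \<pi> v" if "left_branching T \<pi> u"
    using that v(2) seg by (fastforce simp: left_branching_def right_branching_def segment_def)
  show "left_branching T \<pi> v" if "right_branching T \<pi> u"
    using that v(2) seg by (fastforce simp: left_branching_def right_branching_def segment_def)
qed

end

theorem theorem1:
  fixes T :: "('a, 'b) pre_digraph" and r :: 'a and \<pi> :: "'a \<Rightarrow> nat"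
  assumes "rooted_tree T r"
    and "max_projective T r \<pi>"
  shows "(\<forall>u \<in> verts T. children_on_one_side T \<pi> u \<and> children_sorted_by_size T \<pi> u) \<and>
    (\<forall>u v. u \<rightarrow>\<^bsub>T\<^esub> v \<longrightarrow>
      (left_branching T \<pi> u \<longrightarrow> right_branching T \<pi> v) \<and>
      (right_branching T \<pi> u \<longrightarrow> left_branching T \<pi> v))"
proof -
  interpret rooted_tree T r by (rule assms(1))
  show ?thesis
    using max_projective_children_on_one_side[OF assms(2)]
      max_projective_children_sorted_by_size[OF assms(2)] max_projective_alternates[OF assms(2)]
    by blast
qed

end
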